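(* Let $S^1=\{u\in\mathbb R^2:|u|=1\}$ with the arc length metric. For every positive integer $n\neq 2$, $$\mu_n(S^1)= \frac{1}{2}n^2+\begin{cases} n & n\bmod 4=0,\\ \frac{1}{2}n& n\bmod 4=1,\\ 2 & n\bmod 4=2,\\ \frac{1}{2}n-1 & n\bmod 4=3. \end{cases}$$
   Context: For a metric space $(M,d_M)$, a triple $(a,b,c)\in M^3$ is a 3-term arithmetic progression if $d_M(a,b)=d_M(b,c)=\frac12 d_M(a,c)$ (constant triples included). For finite $A\subseteq M$, $\mathrm{AP}_3(M;A)$ is the set of such triples in $A^3$, and $\mu_n(M):=\max\{|\mathrm{AP}_3(M;A)| : A\subseteq M,\ |A|=n\}$. *)

theory Defs
  imports "HOL-Analysis.Analysis"
begin

definition AP3 :: "'a metric \<Rightarrow> 'a set \<Rightarrow> ('a \<times> 'a \<times> 'a) set" where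
  "AP3 M A = {(a, b, c). a \<in> A \<and> b \<in> A \<and> c \<in> A \<and>
      mdist M a b = mdist M b c \<and> mdist M b c = 1 / 2 * mdist M a c}"

(* The explicit finiteness matters only for n = 0, since card is 0 on infinite sets.
   The maximum is over a set bounded by n^3, so Max is meaningful as soon as mspace M
   has a subset of cardinality n. *)
definition mu :: "'a metric \<Rightarrow> nat \<Rightarrow> nat" where
  "mu M n = Max {card (AP3 M A) | A. A \<subseteq> mspace M \<and> finite A \<and> card A = n}"

definition circle_point :: "real \<Rightarrow> real ^ 2" where
  "circle_point t = vector [cos t, sin t]"

(* The points with parameters between s and t trace an arc of length \<bar>s - t\<bar>, so this
   is the infimum of the lengths of the arcs joining u to v.  Off the circle the value is
   irrelevant; it is set to 0 because Metric_space asks for nonnegativity everywhere. *)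
definition arc_length_dist :: "real ^ 2 \<Rightarrow> real ^ 2 \<Rightarrow> real" where
  "arc_length_dist u v =
     (if norm u = 1 \<and> norm v = 1
      then Inf {\<bar>s - t\<bar> | s t. circle_point s = u \<and> circle_point t = v}
      else 0)"

definition circle_metric :: "(real ^ 2) metric" where
  "circle_metric = metric ({u. norm u = 1}, arc_length_dist)"

lemma circle_point_nth [simp]: "circle_point t $ 1 = cos t" "circle_point t $ 2 = sin t"
  by (simp_all add: circle_point_def vector_2)

lemma circle_point_eq_iff:
  "circle_point s = circle_point t \<longleftrightarrow> (\<exists>k::int. s = t + 2 * pi * k)"
  using sin_cos_eq_iff[of s t] by (auto simp: vec_eq_iff forall_2)

lemma circle_point_exists:
  assumes "norm u = 1"
  obtains t where "circle_point t = u"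
proof -
  have "(u $ 1)\<^sup>2 + (u $ 2)\<^sup>2 = 1"
    using assms by (simp add: norm_vec_def L2_set_def sum_2)
  then obtain t where "u $ 1 = cos t" "u $ 2 = sin t"
    using sincos_total_2pi by metis
  then have "circle_point t = u" by (simp add: vec_eq_iff forall_2)
  with that show thesis .
qed

lemma dist_circle_point_le: "dist (circle_point s) (circle_point t) \<le> \<bar>s - t\<bar>"
proof -
  have "(dist (circle_point s) (circle_point t))\<^sup>2 = (cos s - cos t)\<^sup>2 + (sin s - sin t)\<^sup>2"
    by (simp add: dist_norm norm_vec_def L2_set_def sum_2)
  also have "\<dots> = 2 - 2 * cos (s - t)"
    using sin_cos_squared_add[of s] sin_cos_squared_add[of t]
    by (simp add: cos_diff power2_eq_square algebra_simps)
  also have "\<dots> = 4 * (sin ((s - t) / 2))\<^sup>2"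
  proof -
    have "cos (s - t) = 1 - 2 * (sin ((s - t) / 2))\<^sup>2"
      using cos_double_sin[of "(s - t) / 2"] by (metis field_sum_of_halves mult_2)
    then show ?thesis by simp
  qed
  also have "\<dots> \<le> 4 * \<bar>(s - t) / 2\<bar>\<^sup>2"
    using abs_sin_x_le_abs_x[of "(s - t) / 2"] abs_le_square_iff by fastforce
  also have "\<dots> = \<bar>s - t\<bar>\<^sup>2" by (simp add: power2_eq_square)
  finally show ?thesis by (rule power2_le_imp_le) simp
qed

lemma Metric_space_circle: "Metric_space {u. norm u = 1} arc_length_dist"
proof -
  define L where "L u v = {\<bar>s - t\<bar> | s t. circle_point s = u \<and> circle_point t = v}" for u v
  have ne: "L u v \<noteq> {}" if "norm u = 1" "norm v = 1" for u v
    using that circle_point_exists unfolding L_def by (smt (verit) Collect_empty_eq)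
  have bdd: "bdd_below (L u v)" for u v
    by (rule bdd_belowI[of _ 0]) (auto simp: L_def)
  have dist_le: "dist u v \<le> p" if "p \<in> L u v" for u v p
    using that dist_circle_point_le unfolding L_def by blast
  have d: "arc_length_dist u v = Inf (L u v)" if "norm u = 1" "norm v = 1" for u v
    using that by (simp add: arc_length_dist_def L_def)
  show ?thesis
  proof
    fix x y :: "real ^ 2"
    show "0 \<le> arc_length_dist x y"
    proof (cases "norm x = 1 \<and> norm y = 1")
      case True
      have "0 \<le> Inf (L x y)" using True ne by (intro cInf_greatest) (auto simp: L_def)
      with True d show ?thesis by simp
    qed (auto simp: arc_length_dist_def)
    have "L x y = L y x" unfolding L_def by (auto, (metis abs_minus_commute)+)
    then show "arc_length_dist x y = arc_length_dist y x"
      by (simp add: arc_length_dist_def L_def conj_commute)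
  next
    fix x y :: "real ^ 2" assume "x \<in> {u. norm u = 1}" "y \<in> {u. norm u = 1}"
    then have n: "norm x = 1" "norm y = 1" by auto
    have "dist x y \<le> arc_length_dist x y"
      unfolding d[OF n] using ne[OF n]
      by (intro cInf_greatest) (auto intro: dist_le)
    moreover have "arc_length_dist x y \<le> 0" if "x = y"
    proof -
      obtain t where "circle_point t = x" using circle_point_exists n by blast
      then have "0 \<in> L x y" using that by (auto simp: L_def intro!: exI[of _ t])
      then show ?thesis unfolding d[OF n] using bdd by (rule cInf_lower)
    qed
    moreover have "0 \<le> dist x y" by simp
    ultimately show "arc_length_dist x y = 0 \<longleftrightarrow> x = y"
      by (metis dist_eq_0_iff order_antisym order_trans)
  next
    fix x y z :: "real ^ 2" assume "x \<in> {u. norm u = 1}" "y \<in> {u. norm u = 1}" "z \<in> {u. norm u = 1}"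
    then have n: "norm x = 1" "norm y = 1" "norm z = 1" by auto
    have *: "Inf (L x z) \<le> p + q" if pq: "p \<in> L x y" "q \<in> L y z" for p q
    proof -
      from pq obtain s t t' r where
        st: "p = \<bar>s - t\<bar>" "circle_point s = x" "circle_point t = y" and
        tr: "q = \<bar>t' - r\<bar>" "circle_point t' = y" "circle_point r = z"
        unfolding L_def by auto
      from st tr obtain k :: int where k: "t = t' + 2 * pi * k"
        using circle_point_eq_iff by metis
      have "circle_point (r + 2 * pi * k) = z"
        using tr circle_point_eq_iff by metis
      then have "\<bar>s - (r + 2 * pi * k)\<bar> \<in> L x z" using st by (auto simp: L_def)
      then have "Inf (L x z) \<le> \<bar>s - (r + 2 * pi * k)\<bar>" using bdd by (rule cInf_lower)
      also have "\<dots> \<le> p + q" using st tr k by linarith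
      finally show ?thesis .
    qed
    have "Inf (L x z) - q \<le> Inf (L x y)" if "q \<in> L y z" for q
      using ne[OF n(1,2)] *[OF _ that] by (intro cInf_greatest) (auto simp: algebra_simps)
    then have "Inf (L x z) - Inf (L x y) \<le> Inf (L y z)"
      using ne[OF n(2,3)] by (intro cInf_greatest) (auto simp: algebra_simps)
    then show "arc_length_dist x z \<le> arc_length_dist x y + arc_length_dist y z"
      using n d by simp
  qed
qed

lemma mspace_circle_metric [simp]: "mspace circle_metric = {u. norm u = 1}"
  and mdist_circle_metric [simp]: "mdist circle_metric = arc_length_dist"
  by (simp_all add: circle_metric_def Metric_space.mspace_metric[OF Metric_space_circle]
      Metric_space.mdist_metric[OF Metric_space_circle])

end

theory Submission
  imports Defs
begin

text \<open>
  Enumerate the points of \<open>A\<close> cyclically by angle as \<open>p i\<close> and let \<open>f i\<close> count the nonconstant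
  progressions with middle \<open>p i\<close>, up to reversal; then \<open>card (AP3 M A) = n + 2 * (\<Sum>i. f i)\<close>.
  Since \<open>f i = k\<close> forces \<open>p (i - k)\<close> and \<open>p (i + k)\<close> to lie within a quarter turn of \<open>p i\<close>,
  comparing \<open>i\<close> with the index \<open>i + q\<close> half way around (\<open>q = n div 2\<close>) gives \<open>f i + f (i + q) \<le> q\<close>.
  Summing settles every case but \<open>n mod 4 = 2\<close>.  There, equality at \<open>i\<close> makes \<open>p i\<close> a vertex of an
  inscribed square and the line through it an axis of symmetry of \<open>A\<close>.  If there are at least two
  such axes, \<open>A\<close> is invariant under a rotation, and at the vertex a quarter turn after \<open>p i\<close> the
  bound fails to be attained by at least 2; this compensates all equalities.

  Equality is attained by the regular \<open>n\<close>-gon when \<open>n mod 4 \<le> 1\<close>, and otherwise by the regular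
  \<open>4 * k\<close>-gon without one vertex, or without two vertices at distance two.
\<close>

section \<open>Progressions on the circle in angular coordinates\<close>

lemma shift_into_period:
  fixes a c x :: real
  assumes "c > 0"
  obtains z :: int where "a \<le> x + c * of_int z" "x + c * of_int z < a + c"
proof -
  define z where "z = \<lceil>(a - x) / c\<rceil>"
  have "(a - x) / c \<le> of_int z" "of_int z < (a - x) / c + 1" unfolding z_def by linarith+
  then have "a - x \<le> c * of_int z" "c * of_int z < a - x + c"
    using assms by (simp_all add: field_simps)
  then show thesis using that[of z] by linarith
qed

lemma circle_point_add_2pi [simp]: "circle_point (t + 2 * pi * of_int k) = circle_point t"
  by (auto simp: circle_point_eq_iff)

lemma norm_circle_point [simp]: "norm (circle_point t) = 1"
  by (simp add: norm_vec_def L2_set_def sum_2)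

text \<open>Angles representing the two points differ by \<open>2 * pi * k - x\<close> for an
  integer \<open>k\<close>. For \<open>k \<noteq> 0\<close> this is at least
  \<open>2 * pi - \<bar>x\<bar>\<close>, hence at least \<open>\<bar>x\<bar>\<close>, so the infimum
  is attained at \<open>k = 0\<close>.\<close>

lemma arc_length_dist_circle_point:
  assumes "\<bar>x\<bar> \<le> pi"
  shows "arc_length_dist (circle_point s) (circle_point (s + x)) = \<bar>x\<bar>"
proof -
  have "\<bar>x\<bar> \<le> \<bar>s' - t'\<bar>"
    if eqs: "circle_point s' = circle_point s" "circle_point t' = circle_point (s + x)" for s' t'
  proof -
    obtain a :: int where a: "s' = s + 2 * pi * a"
      using eqs(1) unfolding circle_point_eq_iff ..
    obtain b :: int where "t' = s + x + 2 * pi * b"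
      using eqs(2) unfolding circle_point_eq_iff ..
    with a have eq: "s' - t' = 2 * pi * of_int (a - b) - x" by (simp add: algebra_simps)
    show ?thesis
    proof (cases "a = b")
      case False
      then have "1 \<le> \<bar>of_int (a - b) :: real\<bar>" by linarith
      then have "2 * pi * 1 \<le> 2 * pi * \<bar>of_int (a - b)\<bar>" by (intro mult_left_mono) auto
      then have "2 * pi \<le> \<bar>2 * pi * of_int (a - b)\<bar>" by (simp add: abs_mult)
      with eq assms show ?thesis by linarith
    qed (use eq in simp)
  qed
  moreover have "\<bar>x\<bar> = \<bar>s - (s + x)\<bar>" by simp
  ultimately have "Inf {\<bar>s' - t'\<bar> | s' t'. circle_point s' = circle_point s
      \<and> circle_point t' = circle_point (s + x)} = \<bar>x\<bar>"
    by (intro cInf_eq_minimum) blast+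
  then show ?thesis by (simp add: arc_length_dist_def)
qed

lemma circle_point_near:
  assumes "norm u = 1"
  obtains x where "\<bar>x\<bar> \<le> pi" "u = circle_point (t + x)"
proof -
  obtain s where s: "circle_point s = u" using circle_point_exists assms by blast
  obtain k :: int where "- pi \<le> s - t + 2 * pi * of_int k" "s - t + 2 * pi * of_int k < - pi + 2 * pi"
    using shift_into_period[of "2 * pi" "- pi" "s - t"] by auto
  then have "\<bar>s - t + 2 * pi * of_int k\<bar> \<le> pi" by linarith
  moreover have "u = circle_point (t + (s - t + 2 * pi * of_int k))"
    using circle_point_add_2pi[of s k] s by simp
  ultimately show thesis using that by blast
qed

text \<open>Measure \<open>a\<close> and \<open>c\<close> from the middle by displacements
  \<open>x\<close> and \<open>y\<close>. The first equation gives
  \<open>\<bar>x\<bar> = \<bar>y\<bar>\<close>. If \<open>y = x\<close>, then \<open>a = c\<close>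
  and all distances vanish. If \<open>y = - x\<close>, the second equation rules out steps longer
  than a quarter turn, since the shorter arc from \<open>a\<close> to \<open>c\<close> then avoids
  \<open>b\<close>. A signed \<open>r\<close> covers both orientations, and \<open>r = 0\<close> the
  constant triples.\<close>

lemma AP3_circle:
  assumes "A \<subseteq> {u. norm u = 1}"
  shows "AP3 circle_metric A = {(circle_point (t - r), circle_point t, circle_point (t + r)) | t r.
    \<bar>r\<bar> \<le> pi / 2 \<and> circle_point (t - r) \<in> A \<and> circle_point t \<in> A \<and> circle_point (t + r) \<in> A}"
    (is "_ = ?R")
proof (intro equalityI subsetI)
  fix w assume "w \<in> AP3 circle_metric A"
  then obtain a b c where w: "w = (a, b, c)" and A: "a \<in> A" "b \<in> A" "c \<in> A"
    and d: "arc_length_dist a b = arc_length_dist b c"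
      "arc_length_dist b c = 1 / 2 * arc_length_dist a c"
    by (auto simp: AP3_def)
  obtain t where t: "circle_point t = b" using A assms circle_point_exists by blast
  obtain x where x: "\<bar>x\<bar> \<le> pi" "a = circle_point (t + x)"
    using A assms circle_point_near[of a t] by blast
  obtain y where y: "\<bar>y\<bar> \<le> pi" "c = circle_point (t + y)"
    using A assms circle_point_near[of c t] by blast
  have ab: "arc_length_dist a b = \<bar>x\<bar>"
    using arc_length_dist_circle_point[of "- x" "t + x"] x t by simp
  have bc: "arc_length_dist b c = \<bar>y\<bar>"
    using arc_length_dist_circle_point[of y t] y t by simp
  have "y = - x \<and> \<bar>y\<bar> \<le> pi / 2"
  proof (cases "y = x")
    case True
    then have "arc_length_dist a c = 0"
      using arc_length_dist_circle_point[of 0 "t + x"] x y by simp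
    then show ?thesis using d bc True by simp
  next
    case False
    then have yx: "y = - x" using ab bc d by linarith
    have "\<bar>x\<bar> \<le> pi / 2"
    proof (rule ccontr)
      assume big: "\<not> \<bar>x\<bar> \<le> pi / 2"
      \<comment> \<open>The full turn with the sign of \<open>x\<close> replaces the displacement
        \<open>- 2 * x\<close> from \<open>a\<close> to \<open>c\<close> by the shorter one, of
        length \<open>2 * pi - 2 * \<bar>x\<bar>\<close>.\<close>
      define k :: int where "k = (if x > 0 then 1 else - 1)"
      have "c = circle_point (t + x + (2 * pi * of_int k - 2 * x))"
        using circle_point_add_2pi[of "t - x" k] y yx by (simp add: algebra_simps)
      moreover have abs: "\<bar>2 * pi * of_int k - 2 * x\<bar> = 2 * pi - 2 * \<bar>x\<bar>"
        using x by (auto simp: k_def)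
      ultimately have "arc_length_dist a c = 2 * pi - 2 * \<bar>x\<bar>"
        using arc_length_dist_circle_point[of "2 * pi * of_int k - 2 * x" "t + x"] x big by simp
      then show False using d bc yx big by simp
    qed
    with yx show ?thesis by simp
  qed
  then have "w = (circle_point (t - y), circle_point t, circle_point (t + y))" "\<bar>y\<bar> \<le> pi / 2"
    using w x y t by auto
  then show "w \<in> ?R" using A w by blast
next
  fix w assume "w \<in> ?R"
  then obtain t r where r: "\<bar>r\<bar> \<le> pi / 2"
    and w: "w = (circle_point (t - r), circle_point t, circle_point (t + r))"
    and A: "circle_point (t - r) \<in> A" "circle_point t \<in> A" "circle_point (t + r) \<in> A"
    by blast
  have "arc_length_dist (circle_point (t - r)) (circle_point t) = \<bar>r\<bar>"
    using arc_length_dist_circle_point[of r "t - r"] r by simp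
  moreover have "arc_length_dist (circle_point t) (circle_point (t + r)) = \<bar>r\<bar>"
    using arc_length_dist_circle_point[of r t] r by simp
  moreover have "arc_length_dist (circle_point (t - r)) (circle_point (t + r)) = 2 * \<bar>r\<bar>"
    using arc_length_dist_circle_point[of "2 * r" "t - r"] r by (simp add: abs_mult add.commute)
  ultimately show "w \<in> AP3 circle_metric A" using A w by (simp add: AP3_def)
qed

section \<open>Periodic enumerations of finite subsets of the circle\<close>

text \<open>The angles are lifted to the real line, so that the \<open>k\<close>-th neighbour of a
  point is reached by adding \<open>k\<close> to its index, without wraparound.\<close>

locale circular_enumeration =
  fixes p :: "int \<Rightarrow> real" and n :: nat
  assumes mono: "strict_mono p"
    and period: "p (i + int n) = p i + 2 * pi"
    and pos: "n > 0"
begin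

abbreviation B :: "real set" where "B \<equiv> range p"

definition D :: "int \<Rightarrow> real set" where
  "D i = {r. 0 < r \<and> r \<le> pi / 2 \<and> p i + r \<in> B \<and> p i - r \<in> B}"

text \<open>Integer-valued, because \<open>f i\<close> is also used as a shift of indices.\<close>

definition f :: "int \<Rightarrow> int" where "f i = int (card (D i))"

lemma p_less [simp]: "p i < p j \<longleftrightarrow> i < j"
  using mono by (simp add: strict_mono_less)

lemma p_le [simp]: "p i \<le> p j \<longleftrightarrow> i \<le> j"
  using mono by (simp add: strict_mono_less_eq)

lemma p_eq [simp]: "p i = p j \<longleftrightarrow> i = j"
  using mono by (simp add: strict_mono_eq)

lemma p_shift: "p (i + int n * z) = p i + 2 * pi * of_int z"
proof (induction z rule: int_induct[where k = 0])
  case (step1 z)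
  then show ?case using period[of "i + int n * z"] by (simp add: algebra_simps)
next
  case (step2 z)
  then show ?case using period[of "i + int n * (z - 1)"] by (simp add: algebra_simps)
qed simp

lemma p_mod: "p i = p (i mod int n) + 2 * pi * of_int (i div int n)"
  using p_shift[of "i mod int n" "i div int n"] by simp

lemma B_shift: "x + 2 * pi * of_int z \<in> B \<longleftrightarrow> x \<in> B"
proof
  show "x + 2 * pi * of_int z \<in> B" if "x \<in> B" for x z
    using that p_shift by (metis rangeE rangeI)
  from this[of "x + 2 * pi * of_int z" "- z"]
  show "x \<in> B" if "x + 2 * pi * of_int z \<in> B" using that by simp
qed

lemma f_nonneg [simp]: "0 \<le> f i" by (simp add: f_def)

lemma f_shift: "f (i + int n * z) = f i"
proof -
  have "p i + 2 * pi * of_int z + r = (p i + r) + 2 * pi * of_int z"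
    "p i + 2 * pi * of_int z - r = (p i - r) + 2 * pi * of_int z" for r by auto
  then have "D (i + int n * z) = D i" unfolding D_def p_shift by (simp only: B_shift)
  then show ?thesis by (simp add: f_def)
qed

lemma f_mod: "f (i mod int n) = f i"
  using f_shift[of "i mod int n" "i div int n"] by simp

text \<open>Every radius in \<open>D i\<close> is the distance from \<open>p i\<close> to one of the
  next \<open>k\<close> points, since later points are more than a quarter turn away. If all
  \<open>k\<close> distances are radii, each point in the quarter after \<open>p i\<close> has its
  mirror image in \<open>B\<close>. The next lemma is the same on the other side.\<close>

lemma
  assumes "p i + pi / 2 < p (i + k + 1)" "0 \<le> k"
  shows f_le_right: "f i \<le> k"
    and f_eq_right: "f i = k \<Longrightarrow> x \<in> B \<Longrightarrow> p i < x \<Longrightarrow> x \<le> p i + pi / 2 \<Longrightarrow> 2 * p i - x \<in> B"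
    and finite_D: "finite (D i)"
proof -
  define S where "S = (\<lambda>s. p (i + s) - p i) ` {1..k}"
  have S: "r \<in> S" if "0 < r" "r \<le> pi / 2" "p i + r \<in> B" for r
  proof -
    from that obtain j where j: "p i + r = p j" by blast
    then have "p i < p j" "p j < p (i + k + 1)" using that assms by linarith+
    then have "j - i \<in> {1..k}" by simp
    moreover have "r = p (i + (j - i)) - p i" using j by simp
    ultimately show ?thesis unfolding S_def by blast
  qed
  have fin: "finite S" and card: "card S = nat k"
    unfolding S_def by (auto simp: card_image inj_on_def)
  have sub: "D i \<subseteq> S" using S by (auto simp: D_def)
  then show "finite (D i)" using fin finite_subset by blast
  show "f i \<le> k" using card_mono[OF fin sub] card assms by (simp add: f_def)
  assume "f i = k" "x \<in> B" "p i < x" "x \<le> p i + pi / 2"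
  then have "D i = S" using card_subset_eq[OF fin sub] card by (simp add: f_def)
  then have "x - p i \<in> D i" using S \<open>x \<in> B\<close> \<open>p i < x\<close> \<open>x \<le> p i + pi / 2\<close> by simp
  then show "2 * p i - x \<in> B" by (simp add: D_def)
qed

lemma
  assumes "p (i - k - 1) < p i - pi / 2" "0 \<le> k"
  shows f_le_left: "f i \<le> k"
    and f_eq_left: "f i = k \<Longrightarrow> x \<in> B \<Longrightarrow> x < p i \<Longrightarrow> p i - pi / 2 \<le> x \<Longrightarrow> 2 * p i - x \<in> B"
proof -
  define S where "S = (\<lambda>s. p i - p (i - s)) ` {1..k}"
  have S: "r \<in> S" if "0 < r" "r \<le> pi / 2" "p i - r \<in> B" for r
  proof -
    from that obtain j where j: "p i - r = p j" by blast
    then have "p j < p i" "p (i - k - 1) < p j" using that assms by linarith+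
    then have "i - j \<in> {1..k}" by simp
    moreover have "r = p i - p (i - (i - j))" using j by simp
    ultimately show ?thesis unfolding S_def by blast
  qed
  have fin: "finite S" and card: "card S = nat k"
    unfolding S_def by (auto simp: card_image inj_on_def)
  have sub: "D i \<subseteq> S" using S by (auto simp: D_def)
  show "f i \<le> k" using card_mono[OF fin sub] card assms by (simp add: f_def)
  assume "f i = k" "x \<in> B" "x < p i" "p i - pi / 2 \<le> x"
  then have "D i = S" using card_subset_eq[OF fin sub] card by (simp add: f_def)
  then have "p i - x \<in> D i" using S \<open>x \<in> B\<close> \<open>x < p i\<close> \<open>p i - pi / 2 \<le> x\<close> by simp
  then show "2 * p i - x \<in> B" by (simp add: D_def)
qed

lemma finite_D' [simp]: "finite (D i)"
proof (rule finite_D)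
  show "p i + pi / 2 < p (i + int n + 1)"
    using period[of i] p_less[of "i + int n" "i + int n + 1"] pi_gt_zero by linarith
qed simp

section \<open>Pairing each index with the one half way around\<close>

definition Q :: "int \<Rightarrow> int \<Rightarrow> bool" where
  "Q i k \<longleftrightarrow> p (i + k) \<le> p i + pi / 2 \<and> p i - pi / 2 \<le> p (i - k)"

lemma Q_antimono: "Q i k \<Longrightarrow> k' \<le> k \<Longrightarrow> Q i k'"
  unfolding Q_def using p_le[of "i + k'" "i + k"] p_le[of "i - k" "i - k'"] by linarith

text \<open>If the \<open>f i\<close>-th neighbour on some side were beyond a quarter turn, the
  one-sided bounds would give \<open>f i \<le> f i - 1\<close>. The pairing bound is stated for
  \<open>Q\<close> rather than \<open>f\<close>, so that \<open>tight_defect\<close> can apply it to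
  \<open>f v + 1\<close>.\<close>

lemma Q_f: "Q i (f i)"
proof (cases "f i = 0")
  case False
  then have "0 \<le> f i - 1" using f_nonneg[of i] by linarith
  then have "\<not> p i + pi / 2 < p (i + f i)" "\<not> p (i - f i) < p i - pi / 2"
    using f_le_right[of i "f i - 1"] f_le_left[of i "f i - 1"] by auto
  then show ?thesis by (simp add: Q_def)
qed (simp add: Q_def)

text \<open>If \<open>k + l > q\<close>, the two index ranges around \<open>i\<close> and
  \<open>i + q\<close> overlap on one side, which forces \<open>p (i + q) - p i < pi\<close>. On the
  other side they at least touch, which forces \<open>p (i + q) - p i \<ge> pi\<close>.\<close>

lemma Q_add_le:
  assumes "Q i k" "Q (i + q) l" "int n = 2 * q \<or> int n = 2 * q + 1"
  shows "k + l \<le> q"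
proof (rule ccontr)
  assume "\<not> k + l \<le> q"
  then have "p (i + q - l) < p (i + k)" "p (i - k + int n) \<le> p (i + q + l)"
    "int n = 2 * q \<Longrightarrow> p (i - k + int n) < p (i + q + l)"
    using assms(3) by auto
  then show False using assms(1,2) period[of "i - k"] unfolding Q_def by argo
qed

text \<open>For \<open>k + l = q\<close> the end indices of the two ranges coincide on both sides,
  so all four quarter-turn inequalities must be equalities.\<close>

lemma Q_add_eq:
  assumes "Q i k" "Q (i + q) l" "int n = 2 * q" "k + l = q"
  shows "p (i + q) = p i + pi" "p (i + k) = p i + pi / 2" "p (i - k) = p i - pi / 2"
proof -
  have "i + q - l = i + k" "i + q + l = i - k + int n" using assms by auto
  then have "p (i + q - l) = p (i + k)" "p (i + q + l) = p (i - k) + 2 * pi"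
    using period by metis+
  then show "p (i + q) = p i + pi" "p (i + k) = p i + pi / 2" "p (i - k) = p i - pi / 2"
    using assms(1,2) unfolding Q_def by linarith+
qed

lemma f_add_le: "int n = 2 * q \<or> int n = 2 * q + 1 \<Longrightarrow> f i + f (i + q) \<le> q"
  using Q_add_le Q_f by blast

lemma sum_shift:
  assumes "\<And>i. g (i mod int n) = g i"
  shows "(\<Sum>i\<in>{0..<int n}. g (i + q)) = (\<Sum>i\<in>{0..<int n}. g i)"
proof (rule sum.reindex_bij_witness[where i = "\<lambda>i. (i - q) mod int n" and j = "\<lambda>i. (i + q) mod int n"])
qed (use pos assms in \<open>auto simp: mod_simps\<close>)

lemma sum_f_pairs:
  "2 * (\<Sum>i\<in>{0..<int n}. f i) = (\<Sum>i\<in>{0..<int n}. f i + f (i + q))"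
  using sum_shift[of f q] f_mod by (simp add: sum.distrib)

lemma sum_f_le:
  assumes "int n = 2 * q \<or> int n = 2 * q + 1"
  shows "2 * (\<Sum>i\<in>{0..<int n}. f i) \<le> int n * q"
proof -
  have "(\<Sum>i\<in>{0..<int n}. f i + f (i + q)) \<le> (\<Sum>i\<in>{0..<int n}. q)"
    using f_add_le[OF assms] by (intro sum_mono) auto
  then show ?thesis by (simp add: sum_f_pairs[of q])
qed

section \<open>The equality case and its symmetries\<close>

lemma tight_square:
  assumes "int n = 2 * q" "f i + f (i + q) = q"
  shows "p (i + q) = p i + pi" "p (i + f i) = p i + pi / 2" "p (i - f i) = p i - pi / 2"
  using Q_add_eq[OF Q_f Q_f] assms by auto

lemma tight_opposite:
  assumes "int n = 2 * q" "f i + f (i + q) = q"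
  shows "f (i + q) + f (i + q + q) = q"
  using f_shift[of i 1] assms by (simp add: algebra_simps)

text \<open>The \<open>f i\<close>-th neighbours lie exactly a quarter turn away, so
  \<open>f i\<close> is the number of points in each adjacent quarter and the equality cases of both
  one-sided bounds apply.\<close>

lemma tight_half:
  assumes "int n = 2 * q" "f i + f (i + q) = q" "x \<in> B" "\<bar>x - p i\<bar> \<le> pi / 2"
  shows "2 * p i - x \<in> B"
proof -
  have right: "p i + pi / 2 < p (i + f i + 1)" and left: "p (i - f i - 1) < p i - pi / 2"
    using p_less[of "i + f i" "i + f i + 1"] p_less[of "i - f i - 1" "i - f i"]
      tight_square[OF assms(1,2)] by linarith+
  have x: "x \<le> p i + pi / 2" "p i - pi / 2 \<le> x" using assms(4) by linarith+
  consider "p i < x" | "x < p i" | "x = p i" by linarith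
  then show ?thesis
  proof cases
    case 1
    then show ?thesis by (rule f_eq_right[OF right f_nonneg refl assms(3) _ x(1)])
  next
    case 2
    then show ?thesis by (rule f_eq_left[OF left f_nonneg refl assms(3) _ x(2)])
  qed simp
qed

text \<open>The half circles centred at \<open>p i\<close> and at the antipode
  \<open>p (i + q)\<close> cover everything, and both centres are tight. The reflections in the two
  centres agree up to a full turn.\<close>

lemma tight_symmetric:
  assumes "int n = 2 * q" "f i + f (i + q) = q" "x \<in> B"
  shows "2 * p i - x \<in> B"
proof -
  obtain z :: int where "p i - pi / 2 \<le> x + 2 * pi * of_int z"
    "x + 2 * pi * of_int z < p i - pi / 2 + 2 * pi"
    using shift_into_period[of "2 * pi" "p i - pi / 2" x] by auto
  moreover define y where "y = x + 2 * pi * of_int z"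
  ultimately have z: "p i - pi / 2 \<le> y" "y < p i - pi / 2 + 2 * pi" by simp_all
  have y: "y \<in> B" using assms(3) B_shift y_def by simp
  have "2 * p i - y \<in> B"
  proof (cases "y \<le> p i + pi / 2")
    case True
    then have "\<bar>y - p i\<bar> \<le> pi / 2" using z by linarith
    then show ?thesis by (rule tight_half[OF assms(1,2) y])
  next
    case False
    then have "\<bar>y - p (i + q)\<bar> \<le> pi / 2"
      using z tight_square(1)[OF assms(1,2)] by linarith
    then have "2 * p (i + q) - y \<in> B"
      by (rule tight_half[OF assms(1) tight_opposite[OF assms(1,2)] y])
    then show ?thesis
      using B_shift[of "2 * p i - y" 1] tight_square(1)[OF assms(1,2)] by (simp add: algebra_simps)
  qed
  then show ?thesis using B_shift[of "2 * p i - y" z] by (simp add: y_def)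
qed

text \<open>Reflection in \<open>c\<close> extends the half turn from the quarter after
  \<open>c\<close> to the whole half circle centred at \<open>c\<close>. Any point can be moved into
  this half circle by repeating a nontrivial rotation that preserves \<open>B\<close>, and rotations
  commute with the half turn.\<close>

lemma half_turn_invariant:
  assumes sym: "\<And>x. x \<in> B \<Longrightarrow> 2 * c - x \<in> B"
    and quarter: "\<And>x. x \<in> B \<Longrightarrow> c \<le> x \<Longrightarrow> x \<le> c + pi / 2 \<Longrightarrow> x - pi \<in> B"
    and rot: "\<And>x. x \<in> B \<Longrightarrow> x + d \<in> B" "\<And>x. x \<in> B \<Longrightarrow> x - d \<in> B"
    and d: "\<And>z :: int. d \<noteq> 2 * pi * of_int z"
    and x: "x \<in> B"
  shows "x + pi \<in> B"
proof -
  have half: "y + pi \<in> B" if "y \<in> B" "\<bar>y - c\<bar> \<le> pi / 2" for y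
  proof (cases "c \<le> y")
    case True
    then have "y - pi \<in> B" using quarter that by (simp add: abs_le_iff)
    then show ?thesis using B_shift[of "y - pi" 1] by (simp add: add.commute)
  next
    case False
    then have "2 * c - y - pi \<in> B" using quarter sym that by (simp add: abs_le_iff)
    then show ?thesis using sym[of "2 * c - y - pi"] by simp
  qed
  obtain w :: int where w: "0 \<le> d + 2 * pi * of_int w" "d + 2 * pi * of_int w < 2 * pi"
    using shift_into_period[of "2 * pi" 0 d] by auto
  define e where "e = d + 2 * pi * of_int w"
  have "e \<noteq> 0" using d[of "- w"] by (simp add: e_def)
  with w have e: "0 < e" "e < 2 * pi" by (auto simp: e_def)
  have e_rot: "y + e \<in> B" "y - e \<in> B" if "y \<in> B" for y
    using rot[OF that] B_shift[of "y + d" w] B_shift[of "y - d" "- w"]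
    by (simp_all add: e_def algebra_simps)
  \<comment> \<open>Replacing the rotation by its inverse if necessary gives a step of at most
    \<open>pi\<close>, which cannot jump over the window of length \<open>pi\<close> around
    \<open>c\<close>.\<close>
  define r where "r = (if e \<le> pi then e else 2 * pi - e)"
  have r: "0 < r" "r \<le> pi" using e by (auto simp: r_def)
  have r_rot: "y + r \<in> B" "y - r \<in> B" if "y \<in> B" for y
    using e_rot[OF that] B_shift[of "y + e" "- 1"] B_shift[of "y - e" 1]
    by (simp_all add: r_def algebra_simps)
  have multiple: "y + r * of_int l \<in> B" if "y \<in> B" for y l
  proof (induction l rule: int_induct[where k = 0])
    case (step1 l)
    then show ?case using r_rot(1)[of "y + r * of_int l"] by (simp add: algebra_simps)
  next
    case (step2 l)
    then show ?case using r_rot(2)[of "y + r * of_int l"] by (simp add: algebra_simps)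
  qed (use that in simp)
  obtain l :: int where "c - pi / 2 \<le> x + r * of_int l" "x + r * of_int l < c - pi / 2 + r"
    using shift_into_period[OF r(1), of "c - pi / 2" x] by auto
  then have "\<bar>x + r * of_int l - c\<bar> \<le> pi / 2" using r by linarith
  then have "x + r * of_int l + pi \<in> B" by (rule half[OF multiple[OF x]])
  then show ?thesis using multiple[of "x + r * of_int l + pi" "- l"] by simp
qed

lemma card_B_interval: "card {x \<in> B. p a < x \<and> x \<le> p b} = nat (b - a)"
proof -
  have "{x \<in> B. p a < x \<and> x \<le> p b} = p ` {a<..b}" by auto
  then show ?thesis by (simp add: card_image inj_on_def)
qed

text \<open>The half turn carries one quarter arc onto the opposite one, so both contain equally
  many points. This refutes half-turn invariance when opposite quarters have different
  counts.\<close>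

lemma half_turn_counts:
  assumes "\<And>x. x \<in> B \<Longrightarrow> x + pi \<in> B"
    and "p b = p a + pi / 2" "p a' = p a + pi" "p b' = p a' + pi / 2"
  shows "b - a = b' - a'"
proof -
  have "{x \<in> B. p a' < x \<and> x \<le> p b'} = (\<lambda>x. x + pi) ` {x \<in> B. p a < x \<and> x \<le> p b}"
  proof (intro equalityI subsetI)
    fix x assume x: "x \<in> {x \<in> B. p a' < x \<and> x \<le> p b'}"
    then have "x - pi \<in> B" using assms(1)[of x] B_shift[of "x + pi" "- 1"] by simp
    then show "x \<in> (\<lambda>x. x + pi) ` {x \<in> B. p a < x \<and> x \<le> p b}"
      using x assms by (intro image_eqI[of _ _ "x - pi"]) auto
  qed (use assms in auto)
  then have "nat (b' - a') = nat (b - a)"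
    unfolding card_B_interval[symmetric] by (simp add: card_image inj_on_def)
  moreover have "a < b" "a' < b'"
    using p_less[of a b] p_less[of a' b'] assms pi_gt_zero by linarith+
  ultimately show ?thesis by simp
qed

text \<open>The tight indices \<open>i\<close> and \<open>a\<close> give axes in different lines,
  hence a nontrivial rotation preserving \<open>B\<close>. If \<open>f v\<close> reached the size of
  either quarter adjacent to \<open>p v\<close>, the symmetry of that quarter about
  \<open>p v\<close> would make \<open>B\<close> invariant under the half turn. But the quarters
  after \<open>p i\<close> and after \<open>p (i + q)\<close> are opposite, and their sizes
  \<open>k\<close> and \<open>l\<close> differ because \<open>k + l = q\<close> is odd.\<close>

lemma tight_defect:
  assumes n: "int n = 2 * q" and "odd q"
    and i: "f i + f (i + q) = q" and a: "f a + f (a + q) = q"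
    and ia: "\<And>z :: int. p a - p i \<noteq> pi * of_int z"
  defines "v \<equiv> i + f i"
  shows "f v + f (v + q) \<le> q - 2"
proof -
  define k l where "k = f i" and "l = f (i + q)"
  have kl: "k + l = q" "k \<noteq> l" "0 \<le> k" "0 \<le> l"
    using i \<open>odd q\<close> unfolding k_def l_def by auto presburger
  note sq = tight_square[OF n i]
  \<comment> \<open>Seen from \<open>v\<close>, the vertex \<open>p i\<close> is \<open>k\<close>
    places back and \<open>p (i + q)\<close> is \<open>l\<close> places ahead, each at exactly a
    quarter turn.\<close>
  have v: "p v = p i + pi / 2" "v + l = i + q" "v - k = i"
    using sq kl by (auto simp: v_def k_def)
  then have vl: "p (v + l) = p v + pi / 2" and vk: "p (v - k) = p v - pi / 2" using sq by auto
  have right: "p v + pi / 2 < p (v + l + 1)" and left: "p (v - k - 1) < p v - pi / 2"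
    using p_less[of "v + l" "v + l + 1"] p_less[of "v - k - 1" "v - k"] vl vk by linarith+
  have le: "f v \<le> k" "f v \<le> l" using f_le_right[OF right] f_le_left[OF left] kl by auto
  have not_half_turn: "\<exists>x \<in> B. x + pi \<notin> B"
  proof (rule ccontr)
    assume "\<not> ?thesis"
    then have "x + pi \<in> B" if "x \<in> B" for x using that by blast
    then have "i + k - i = i + q + l - (i + q)"
      using half_turn_counts[of "i + k" i "i + q" "i + q + l"] sq
        tight_square(2)[OF n tight_opposite[OF n i]] by (auto simp: k_def l_def)
    then show False using kl by simp
  qed
  \<comment> \<open>Composing the reflections in \<open>p i\<close> and \<open>p a\<close> rotates
    by twice the angle between them.\<close>
  have rot: "x + 2 * (p a - p i) \<in> B" "x - 2 * (p a - p i) \<in> B" if "x \<in> B" for x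
    using tight_symmetric[OF n a tight_symmetric[OF n i that]]
      tight_symmetric[OF n i tight_symmetric[OF n a that]] by (simp_all add: algebra_simps)
  have nontrivial: "2 * (p a - p i) \<noteq> 2 * pi * of_int z" for z using ia[of z] by simp
  \<comment> \<open>With \<open>f v = k\<close> the quarter from \<open>p i\<close> to
    \<open>p v\<close> can be reflected in \<open>p v\<close>. Reflecting again in
    \<open>p i\<close>, a quarter turn away, results in a half turn of that quarter. The case
    \<open>f v = l\<close> is the same with \<open>p (i + q)\<close> for \<open>p i\<close>.\<close>
  have "f v \<noteq> k"
  proof
    assume fv: "f v = k"
    have "x + pi \<in> B" if x: "x \<in> B" for x
    proof (rule half_turn_invariant[OF _ _ rot nontrivial x])
      show "y - pi \<in> B" if "y \<in> B" "p i \<le> y" "y \<le> p i + pi / 2" for y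
      proof -
        have "2 * p v - y \<in> B"
          using f_eq_left[OF left _ fv, of y] that v kl by (cases "y = p v") auto
        then show ?thesis using tight_symmetric[OF n i, of "2 * p v - y"] v by simp
      qed
    qed (use tight_symmetric[OF n i] in auto)
    then show False using not_half_turn by blast
  qed
  moreover have "f v \<noteq> l"
  proof
    assume fv: "f v = l"
    note sym = tight_symmetric[OF n tight_opposite[OF n i]]
    have "x + pi \<in> B" if x: "x \<in> B" for x
    proof (rule half_turn_invariant[OF _ _ rot nontrivial x])
      show "y - pi \<in> B" if y: "y \<in> B" "p (i + q) \<le> y" "y \<le> p (i + q) + pi / 2" for y
      proof -
        have "2 * p v - (2 * p (i + q) - y) \<in> B"
        proof (cases "2 * p (i + q) - y = p v")
          case False
          moreover have "p v \<le> 2 * p (i + q) - y" "2 * p (i + q) - y \<le> p v + pi / 2"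
            using y v sq by linarith+
          ultimately show ?thesis using f_eq_right[OF right _ fv sym[OF y(1)]] kl by auto
        qed simp
        then show ?thesis using v sq B_shift[of "y - pi" 1] by simp
      qed
    qed (use sym in auto)
    then show False using not_half_turn by blast
  qed
  \<comment> \<open>Since \<open>f v\<close> is below both \<open>k\<close> and \<open>l\<close>,
    \<open>Q\<close> still holds at \<open>f v + 1\<close>, which loses one unit in the pairing
    bound. Equality there would place the same number of points in both quarters, that is
    \<open>k = l\<close>, so a second unit is lost.\<close>
  ultimately have lt: "f v + 1 \<le> k" "f v + 1 \<le> l" using le by auto
  then have "p (v + (f v + 1)) \<le> p (v + l)" "p (v - k) \<le> p (v - (f v + 1))" by simp_all
  then have Q: "Q v (f v + 1)" using vl vk by (simp add: Q_def)
  have "f v + 1 + f (v + q) \<noteq> q"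
  proof
    assume eq: "f v + 1 + f (v + q) = q"
    have "p (v + (f v + 1)) = p (v + l)" "p (v - (f v + 1)) = p (v - k)"
      using Q_add_eq[OF Q Q_f n eq] vl vk by simp_all
    then show False using kl by simp
  qed
  then show ?thesis using Q_add_le[OF Q Q_f] n by fastforce
qed

section \<open>The improved bound for odd \<open>q\<close>\<close>

lemma p_cong_mod:
  assumes "p a = p b + 2 * pi * of_int z"
  shows "a mod int n = b mod int n"
  using assms p_shift[of b z] by (metis mod_mult_self2 p_eq)

text \<open>Measure each pair sum against \<open>q - 1\<close>: indices in \<open>T\<close> exceed
  it by 1, and those in \<open>V\<close> fall short by at least 1. Either \<open>T\<close> has at
  most two elements, or the vertex a quarter turn later maps \<open>T\<close> injectively into
  \<open>V\<close>. The total excess is thus at most 2.\<close>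

lemma sum_f_le_odd:
  assumes n: "int n = 2 * q" and "odd q"
  shows "(\<Sum>i\<in>{0..<int n}. f i) \<le> q * (q - 1) + 1"
proof -
  define T where "T = {i \<in> {0..<int n}. f i + f (i + q) = q}"
  define V where "V = {i \<in> {0..<int n}. f i + f (i + q) \<le> q - 2}"
  have fin: "finite T" "finite V"
    by (rule finite_subset[of _ "{0..<int n}"]; auto simp: T_def V_def)+
  have "card T \<le> 2 \<or> card T \<le> card V"
  proof (rule disjCI)
    assume "\<not> card T \<le> card V"
    have "\<not> 2 < card T"
    proof
      assume big: "2 < card T"
      have "(i + f i) mod int n \<in> V" if i: "i \<in> T" for i
      proof -
        have "\<not> T \<subseteq> {i, (i + q) mod int n}"
        proof
          assume "T \<subseteq> {i, (i + q) mod int n}"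
          then have "card T \<le> card {i, (i + q) mod int n}" by (intro card_mono) auto
          also have "\<dots> \<le> 2" by (simp add: card_insert_if)
          finally show False using big by simp
        qed
        \<comment> \<open>A third tight index lies off the axis through \<open>p i\<close>: an even
          multiple of \<open>pi\<close> between \<open>p a\<close> and \<open>p i\<close> would give
          \<open>a = i\<close>, and an odd one the antipodal index.\<close>
        then obtain a where a: "a \<in> T" "a \<noteq> i" "a \<noteq> (i + q) mod int n" by blast
        have modn: "a mod int n = a" "i mod int n = i" using a i by (auto simp: T_def)
        have tight: "f i + f (i + q) = q" "f a + f (a + q) = q" using a i by (auto simp: T_def)
        have "p a - p i \<noteq> pi * of_int z" for z
        proof
          assume eq: "p a - p i = pi * of_int z"
          show False
          proof (cases "even z")
            case True
            then obtain w where "z = 2 * w" by blast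
            then have "p a = p i + 2 * pi * of_int w" using eq by simp
            then show False using p_cong_mod modn a by metis
          next
            case False
            then obtain w where "z = 2 * w + 1" using oddE by blast
            then have "p a = p (i + q) + 2 * pi * of_int w"
              using eq tight_square(1)[OF n tight(1)] by (simp add: algebra_simps)
            then show False using p_cong_mod modn a by metis
          qed
        qed
        then have *: "f (i + f i) + f (i + f i + q) \<le> q - 2"
          using tight_defect[OF n \<open>odd q\<close> tight] by blast
        have "f ((i + f i) mod int n + q) = f (i + f i + q)"
          by (metis f_mod mod_add_left_eq)
        then show ?thesis using * pos by (simp add: V_def f_mod)
      qed
      moreover have "inj_on (\<lambda>i. (i + f i) mod int n) T"
      proof (rule inj_onI)
        fix i j assume ij: "i \<in> T" "j \<in> T" and eq: "(i + f i) mod int n = (j + f j) mod int n"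
        have "p (i + f i) - p (j + f j)
            = 2 * pi * of_int ((i + f i) div int n - (j + f j) div int n)"
          using p_mod[of "i + f i"] p_mod[of "j + f j"] eq by (simp add: algebra_simps)
        then have "p i = p j + 2 * pi * of_int ((i + f i) div int n - (j + f j) div int n)"
          using tight_square(2)[OF n, of i] tight_square(2)[OF n, of j] ij by (simp add: T_def)
        from p_cong_mod[OF this] show "i = j" using ij by (simp add: T_def)
      qed
      ultimately have "card T \<le> card V" using fin by (intro card_inj_on_le[of _ T V]) auto
      with \<open>\<not> card T \<le> card V\<close> show False ..
    qed
    then show "card T \<le> 2" by simp
  qed
  then have "int (card T) - int (card V) \<le> 2" by linarith
  moreover have "(\<Sum>i\<in>{0..<int n}. f i + f (i + q))
      \<le> (\<Sum>i\<in>{0..<int n}. q - 1 + (of_bool (i \<in> T) - of_bool (i \<in> V)))"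
  proof (rule sum_mono)
    fix i assume "i \<in> {0..<int n}"
    then show "f i + f (i + q) \<le> q - 1 + (of_bool (i \<in> T) - of_bool (i \<in> V))"
      using f_add_le[of q i] n by (auto simp: T_def V_def)
  qed
  moreover have "(\<Sum>i\<in>{0..<int n}. q - 1 + (of_bool (i \<in> T) - of_bool (i \<in> V)))
      = int n * (q - 1) + (int (card T) - int (card V))"
  proof -
    have "{0..<int n} \<inter> T = T" "{0..<int n} \<inter> V = V" by (auto simp: T_def V_def)
    then show ?thesis by (simp add: sum.distrib sum_subtractf sum_of_bool_eq Int_def[symmetric])
  qed
  ultimately have "2 * (\<Sum>i\<in>{0..<int n}. f i) \<le> int n * (q - 1) + 2"
    unfolding sum_f_pairs[of q] by linarith
  then show ?thesis using n by simp
qed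

section \<open>Counting progressions by middle point and radius\<close>

lemma card_AP3:
  assumes A: "A \<subseteq> {u. norm u = 1}" and AB: "\<And>t. circle_point t \<in> A \<longleftrightarrow> t \<in> B"
  shows "int (card (AP3 circle_metric A)) = int n + 2 * (\<Sum>i\<in>{0..<int n}. f i)"
proof -
  define E where "E i = {r. \<bar>r\<bar> \<le> pi / 2 \<and> p i + r \<in> B \<and> p i - r \<in> B}" for i
  define h where "h = (\<lambda>(i, r). (circle_point (p i - r), circle_point (p i), circle_point (p i + r)))"
  \<comment> \<open>The radius 0 is the constant triple, and each positive radius counts twice, once
    per orientation; hence \<open>1 + 2 * f i\<close> progressions with middle
    \<open>p i\<close>.\<close>
  have E: "E i = insert 0 (D i \<union> uminus ` D i)" for i
  proof (intro equalityI subsetI)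
    fix r assume "r \<in> E i"
    then have "r = 0 \<or> r \<in> D i \<or> - r \<in> D i" by (auto simp: E_def D_def)
    then show "r \<in> insert 0 (D i \<union> uminus ` D i)" by force
  qed (auto simp: E_def D_def)
  have finE: "finite (E i)" for i by (simp add: E)
  have cardE: "int (card (E i)) = 1 + 2 * f i" for i
  proof -
    have "card (D i \<union> uminus ` D i) = card (D i) + card (uminus ` D i)"
      by (rule card_Un_disjoint) (simp_all, auto simp: D_def)
    moreover have "0 \<notin> D i \<union> uminus ` D i" by (auto simp: D_def)
    ultimately show ?thesis by (simp add: E f_def card_image)
  qed
  have "AP3 circle_metric A = h ` Sigma {0..<int n} E"
  proof (intro equalityI subsetI)
    fix w assume "w \<in> AP3 circle_metric A"
    then obtain t r where w: "w = (circle_point (t - r), circle_point t, circle_point (t + r))"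
      and r: "\<bar>r\<bar> \<le> pi / 2" "t - r \<in> B" "t \<in> B" "t + r \<in> B"
      unfolding AP3_circle[OF A] AB by blast
    then obtain j where j: "t = p j" by blast
    define i z where "i = j mod int n" and "z = j div int n"
    have t: "t = p i + 2 * pi * of_int z" unfolding i_def z_def j by (rule p_mod)
    then have "t - r = p i - r + 2 * pi * of_int z" "t + r = p i + r + 2 * pi * of_int z"
      by simp_all
    then have "w = h (i, r)" "r \<in> E i"
      using w r t by (simp_all only: h_def E_def B_shift circle_point_add_2pi) auto
    moreover have "i \<in> {0..<int n}" using pos by (simp add: i_def)
    ultimately show "w \<in> h ` Sigma {0..<int n} E" by blast
  next
    fix w assume "w \<in> h ` Sigma {0..<int n} E"
    then show "w \<in> AP3 circle_metric A"
      unfolding AP3_circle[OF A] AB h_def E_def by auto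
  qed
  moreover have "inj_on h (Sigma {0..<int n} E)"
  proof (rule inj_onI, clarsimp simp: h_def)
    fix i r j s
    assume ij: "0 \<le> i" "i < int n" "0 \<le> j" "j < int n" and rs: "r \<in> E i" "s \<in> E j"
      and eq: "circle_point (p i) = circle_point (p j)"
        "circle_point (p i + r) = circle_point (p j + s)"
    obtain z where "p i = p j + 2 * pi * of_int z" using eq circle_point_eq_iff by blast
    from p_cong_mod[OF this] have i: "i = j" using ij by simp
    obtain y where y: "p i + r = p j + s + 2 * pi * of_int y" using eq circle_point_eq_iff by blast
    then have "r - s = 2 * pi * of_int y" using i by simp
    \<comment> \<open>Two radii of at most a quarter turn cannot differ by a nonzero multiple of a
      full turn, so the end point determines the radius.\<close>
    moreover have "\<bar>r - s\<bar> \<le> pi" using rs by (auto simp: E_def)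
    ultimately have "\<bar>2 * pi * of_int y\<bar> < 2 * pi * 1" using pi_gt_zero by linarith
    then have "\<bar>of_int y :: real\<bar> < 1" by (simp add: abs_mult)
    then have "y = 0" by linarith
    then show "i = j \<and> r = s" using i y by simp
  qed
  ultimately have "card (AP3 circle_metric A) = (\<Sum>i\<in>{0..<int n}. card (E i))"
    using finE by (simp add: card_image)
  then show ?thesis by (simp add: cardE sum.distrib sum_distrib_left)
qed

end

section \<open>Upper bounds for arbitrary finite subsets of the circle\<close>

lemma enumeration_exists:
  assumes A: "A \<subseteq> {u. norm u = 1}" "finite A" "card A = n" "n > 0"
  obtains p where "circular_enumeration p n" "\<And>t. circle_point t \<in> A \<longleftrightarrow> t \<in> range p"
proof -
  define Th where "Th = {t. 0 \<le> t \<and> t < 2 * pi \<and> circle_point t \<in> A}"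
  have inj: "inj_on circle_point Th"
  proof (rule inj_onI)
    fix s t assume st: "s \<in> Th" "t \<in> Th" and "circle_point s = circle_point t"
    then obtain k :: int where k: "s = t + 2 * pi * of_int k" using circle_point_eq_iff by blast
    then have "\<bar>2 * pi * of_int k\<bar> < 2 * pi * 1" using st by (auto simp: Th_def)
    then have "\<bar>of_int k :: real\<bar> < 1" by (simp add: abs_mult)
    then have "k = 0" by linarith
    then show "s = t" using k by simp
  qed
  have reduce: "\<exists>s\<in>Th. \<exists>z :: int. t = s + 2 * pi * of_int z" if t: "circle_point t \<in> A" for t
  proof -
    obtain z :: int where "0 \<le> t + 2 * pi * of_int z" "t + 2 * pi * of_int z < 2 * pi"
      using shift_into_period[of "2 * pi" 0 t] by auto
    then have "t + 2 * pi * of_int z \<in> Th" using t by (simp add: Th_def)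
    then show ?thesis by (intro bexI[of _ "t + 2 * pi * of_int z"] exI[of _ "- z"]) auto
  qed
  have "circle_point ` Th = A"
  proof (intro equalityI subsetI)
    fix u assume u: "u \<in> A"
    then obtain t where t: "circle_point t = u" using A circle_point_exists by blast
    with u obtain s and z :: int where "s \<in> Th" "t = s + 2 * pi * of_int z"
      using reduce by blast
    then show "u \<in> circle_point ` Th" using t by auto
  qed (auto simp: Th_def)
  then have fin: "finite Th" and card: "card Th = n"
    using A inj by (auto simp: finite_image_iff card_image)
  define xs where "xs = sorted_list_of_set Th"
  have len: "length xs = n" and set: "set xs = Th"
    using fin card by (auto simp: xs_def)
  have nth: "xs ! a < xs ! b" if "a < b" "b < n" for a b
    using that len by (auto simp: xs_def intro: sorted_wrt_nth_less[OF strict_sorted_list_of_set])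
  \<comment> \<open>The sorted angles in \<open>[0, 2 * pi)\<close> form one period; the quotient of
    the index counts full turns.\<close>
  define p where "p i = xs ! nat (i mod int n) + 2 * pi * of_int (i div int n)" for i
  have in_Th: "xs ! nat (i mod int n) \<in> Th" for i
    using set len \<open>n > 0\<close> nth_mem[of "nat (i mod int n)" xs] by (simp add: nat_less_iff)
  have mono: "p i < p j" if "i < j" for i j
  proof (cases "i div int n = j div int n")
    case True
    then have "i mod int n < j mod int n"
      using that div_mult_mod_eq[of i "int n"] div_mult_mod_eq[of j "int n"]
      by (metis add_less_cancel_left)
    moreover have "0 \<le> i mod int n" "j mod int n < int n" using \<open>n > 0\<close> by simp_all
    ultimately have "xs ! nat (i mod int n) < xs ! nat (j mod int n)" by (intro nth) linarith+
    then show ?thesis using True by (simp add: p_def)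
  next
    case False
    moreover have "i div int n \<le> j div int n" using that \<open>n > 0\<close> by (simp add: zdiv_mono1)
    ultimately have "of_int (i div int n) + 1 \<le> (of_int (j div int n) :: real)" by linarith
    then have "2 * pi * (of_int (i div int n) + 1) \<le> 2 * pi * of_int (j div int n)"
      by (intro mult_left_mono) auto
    then have "2 * pi * of_int (i div int n) + 2 * pi \<le> 2 * pi * of_int (j div int n)"
      by (simp add: algebra_simps)
    then show ?thesis using in_Th[of i] in_Th[of j] by (auto simp: p_def Th_def)
  qed
  have "circular_enumeration p n"
    using mono \<open>n > 0\<close> by unfold_locales (auto simp: strict_mono_def p_def algebra_simps)
  moreover have "circle_point t \<in> A \<longleftrightarrow> t \<in> range p" for t
  proof
    assume "circle_point t \<in> A"
    then obtain s and z :: int where s: "s \<in> Th" "t = s + 2 * pi * of_int z"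
      using reduce by blast
    then obtain a where a: "a < n" "s = xs ! a" using set len by (metis in_set_conv_nth)
    then have "t = p (int a + int n * z)" using s by (simp add: p_def)
    then show "t \<in> range p" by blast
  next
    assume "t \<in> range p"
    then show "circle_point t \<in> A" using in_Th by (auto simp: p_def Th_def)
  qed
  ultimately show thesis using that by blast
qed

lemma
  assumes A: "A \<subseteq> {u. norm u = 1}" "finite A" "card A = n" "n > 0"
  shows card_AP3_le: "n = 2 * q \<or> n = 2 * q + 1 \<Longrightarrow> card (AP3 circle_metric A) \<le> n + n * q"
    and card_AP3_le_odd:
      "n = 2 * q \<Longrightarrow> odd q \<Longrightarrow> card (AP3 circle_metric A) \<le> n + 2 * (q * (q - 1) + 1)"
    and even_card_AP3: "even (card (AP3 circle_metric A)) \<longleftrightarrow> even n"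
proof -
  obtain p where p: "circular_enumeration p n" "\<And>t. circle_point t \<in> A \<longleftrightarrow> t \<in> range p"
    using enumeration_exists[OF A] by blast
  interpret circular_enumeration p n by (fact p)
  note card = card_AP3[OF A(1) p(2)]
  have "even (int (card (AP3 circle_metric A))) \<longleftrightarrow> even (int n)" unfolding card by simp
  then show "even (card (AP3 circle_metric A)) \<longleftrightarrow> even n" by simp
  show "card (AP3 circle_metric A) \<le> n + n * q" if "n = 2 * q \<or> n = 2 * q + 1"
  proof -
    have "2 * (\<Sum>i\<in>{0..<int n}. f i) \<le> int n * int q" using that by (intro sum_f_le) auto
    then have "int (card (AP3 circle_metric A)) \<le> int (n + n * q)" unfolding card by simp
    then show ?thesis by linarith
  qed
  show "card (AP3 circle_metric A) \<le> n + 2 * (q * (q - 1) + 1)" if "n = 2 * q" "odd q"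
  proof -
    define k where "k = q * (q - 1)"
    have "int q * (int q - 1) = int k"
      using that unfolding k_def by (cases q) (auto simp: algebra_simps)
    then have "(\<Sum>i\<in>{0..<int n}. f i) \<le> int k + 1"
      using sum_f_le_odd[of "int q"] that by simp
    then have "int (card (AP3 circle_metric A)) \<le> int (n + 2 * (k + 1))"
      unfolding card by simp
    then show ?thesis unfolding k_def by linarith
  qed
qed

section \<open>Subsets of regular polygons\<close>

lemma card_symmetric_interval [simp]: "card {- int m..int m} = 2 * m + 1"
  by (simp add: nat_add_distrib nat_mult_distrib)

text \<open>\<open>A\<close> is the regular \<open>N\<close>-gon without the vertices indexed by
  \<open>X\<close>. A pair in \<open>P\<close> is a middle vertex with a signed step, and
  \<open>M x\<close> collects the pairs whose triple meets vertex \<open>x\<close>. As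
  \<open>4 * m \<le> N\<close>, steps stay within a quarter turn, so pairs avoiding every removed
  vertex yield distinct progressions in \<open>A\<close>.\<close>

lemma AP3_polygon:
  fixes N m :: nat and X :: "int set"
  assumes N: "N > 0" and m: "4 * m \<le> N" and X: "X \<subseteq> {0..<int N}"
    and P_def: "P = {0..<int N} \<times> {- int m..int m}"
    and M_def: "\<And>x. M x = {(b, r) \<in> P. b = x \<or> (b + r) mod int N = x \<or> (b - r) mod int N = x}"
  obtains A where "A \<subseteq> {u. norm u = 1}" "finite A" "card A = N - card X"
    "card (P - (\<Union>x\<in>X. M x)) \<le> card (AP3 circle_metric A)"
proof -
  define g where "g j = circle_point (2 * pi * of_int j / of_nat N)" for j :: int
  have g_eq: "g j = g k \<longleftrightarrow> j mod int N = k mod int N" for j k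
  proof
    assume "g j = g k"
    then obtain z :: int where
      z: "2 * pi * of_int j / real N = 2 * pi * of_int k / real N + 2 * pi * of_int z"
      using circle_point_eq_iff unfolding g_def by meson
    have "2 * pi * of_int j / real N * real N
        = (2 * pi * of_int k / real N + 2 * pi * of_int z) * real N"
      by (simp only: z)
    then have "2 * pi * of_int j = 2 * pi * of_int (k + int N * z)"
      using N by (simp add: algebra_simps)
    then have "of_int j = (of_int (k + int N * z) :: real)"
      by (metis mult_cancel_left pi_neq_zero mult_eq_0_iff zero_neq_numeral)
    then have "j = k + int N * z" by linarith
    then show "j mod int N = k mod int N" by simp
  next
    have "g k = g (k mod int N)" for k
    proof -
      have "real_of_int k = of_int (k mod int N) + real N * of_int (k div int N)"
        by (metis mod_mult_div_eq of_int_add of_int_mult of_int_of_nat_eq)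
      then have "2 * pi * of_int k / real N
          = 2 * pi * of_int (k mod int N) / real N + 2 * pi * of_int (k div int N)"
        using N by (simp add: field_simps)
      then show ?thesis by (simp add: g_def)
    qed
    then show "g j = g k" if "j mod int N = k mod int N" using that by metis
  qed
  define S where "S = {0..<int N} - X"
  define A where "A = g ` S"
  have inj: "inj_on g S" by (auto simp: inj_on_def g_eq S_def)
  have gA: "g j \<in> A" if "j mod int N \<notin> X" for j
  proof -
    have "j mod int N \<in> S" using that N by (simp add: S_def)
    moreover have "g j = g (j mod int N)" by (simp add: g_eq)
    ultimately show ?thesis by (auto simp: A_def)
  qed
  have A: "A \<subseteq> {u. norm u = 1}" "finite A" by (auto simp: A_def g_def S_def)
  have "card S = N - card X"
    unfolding S_def using X by (subst card_Diff_subset) (auto intro: finite_subset)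
  then have cardA: "card A = N - card X" by (simp add: A_def card_image inj)
  define h where "h = (\<lambda>(b, r). (g (b - r), g b, g (b + r)))"
  have "h ` (P - (\<Union>x\<in>X. M x)) \<subseteq> AP3 circle_metric A"
  proof
    fix w assume "w \<in> h ` (P - (\<Union>x\<in>X. M x))"
    then obtain b r where br: "(b, r) \<in> P" "(b, r) \<notin> (\<Union>x\<in>X. M x)" "w = h (b, r)" by auto
    then have bmod: "b mod int N = b" by (simp add: P_def)
    have "b \<notin> X" "(b + r) mod int N \<notin> X" "(b - r) mod int N \<notin> X"
      using br by (auto simp: M_def)
    then have mem: "g b \<in> A" "g (b + r) \<in> A" "g (b - r) \<in> A" using gA bmod by simp_all
    define t s where "t = 2 * pi * of_int b / real N" and "s = 2 * pi * of_int r / real N"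
    have "\<bar>r\<bar> * 4 \<le> int N" using br m by (auto simp: P_def)
    then have "real_of_int (\<bar>r\<bar> * 4) \<le> of_int (int N)" by (simp only: of_int_le_iff)
    then have "\<bar>of_int r\<bar> * 4 \<le> real N" by simp
    then have "pi * (\<bar>of_int r\<bar> * 4) \<le> pi * real N" by (intro mult_left_mono) auto
    then have "\<bar>s\<bar> \<le> pi / 2" using N by (simp add: s_def abs_mult field_simps)
    moreover have "g b = circle_point t" "g (b + r) = circle_point (t + s)"
      "g (b - r) = circle_point (t - s)"
      by (simp_all add: g_def t_def s_def distrib_left right_diff_distrib
          add_divide_distrib diff_divide_distrib)
    ultimately show "w \<in> AP3 circle_metric A"
      using mem br(3) unfolding AP3_circle[OF A(1)] h_def by force
  qed
  moreover have "inj_on h (P - (\<Union>x\<in>X. M x))"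
  proof (rule inj_onI, clarify)
    fix b r b' r'
    assume br: "(b, r) \<in> P" "(b', r') \<in> P" and "h (b, r) = h (b', r')"
    then have b: "b = b'" and "(b + r) mod int N = (b' + r') mod int N"
      by (auto simp: h_def g_eq P_def)
    then have "int N dvd r - r'" by (simp add: mod_eq_dvd_iff)
    \<comment> \<open>The steps differ by at most \<open>2 * m < N\<close>, so their residues modulo
      \<open>N\<close> determine them.\<close>
    moreover have "\<bar>r - r'\<bar> < int N" using br m N by (auto simp: P_def)
    ultimately have "r = r'" using dvd_imp_le_int[of "r - r'" "int N"] by force
    with b show "b = b' \<and> r = r'" by simp
  qed
  moreover have "finite (AP3 circle_metric A)"
    by (rule finite_subset[of _ "A \<times> A \<times> A"]) (use A in \<open>auto simp: AP3_def\<close>)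
  ultimately have "card (P - (\<Union>x\<in>X. M x)) \<le> card (AP3 circle_metric A)"
    by (metis card_image card_mono)
  then show thesis using that A cardA by blast
qed

text \<open>There are \<open>2 * m + 1\<close> pairs with middle \<open>x\<close>, and at most
  \<open>2 * m\<close> further ones for each end equal to \<open>x\<close>. Leaving the zero step
  out of \<open>I\<close> avoids counting the constant triple again.\<close>

lemma card_meeting_le:
  fixes N m :: nat and x :: int
  assumes "N > 0"
  shows "card {(b, r) \<in> {0..<int N} \<times> {- int m..int m}.
    b = x \<or> (b + r) mod int N = x \<or> (b - r) mod int N = x} \<le> 6 * m + 1"
    (is "card ?M \<le> _")
proof -
  define I where "I = {- int m..int m} - {0}"
  define U where "U = Pair x ` {- int m..int m}
    \<union> (\<lambda>r. ((x - r) mod int N, r)) ` I \<union> (\<lambda>r. ((x + r) mod int N, r)) ` I"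
  have I: "card I = 2 * m" "finite I" by (auto simp: I_def)
  have "?M \<subseteq> U"
  proof clarify
    fix b r assume br: "b \<in> {0..<int N}" "r \<in> {- int m..int m}"
      and "b = x \<or> (b + r) mod int N = x \<or> (b - r) mod int N = x"
    moreover have "b = ((b + r) mod int N - r) mod int N" "b = ((b - r) mod int N + r) mod int N"
      using br by (simp_all add: mod_simps)
    ultimately show "(b, r) \<in> U" by (cases "r = 0") (auto simp: U_def I_def)
  qed
  moreover have "finite U" using I by (simp add: U_def)
  ultimately have "card ?M \<le> card U" by (rule card_mono[rotated])
  also have "card U \<le> card (Pair x ` {- int m..int m}) + card ((\<lambda>r. ((x - r) mod int N, r)) ` I)
      + card ((\<lambda>r. ((x + r) mod int N, r)) ` I)"
    unfolding U_def by (meson add_right_mono card_Un_le order_trans)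
  also have "\<dots> \<le> card {- int m..int m} + card I + card I"
    using I by (intro add_mono card_image_le) auto
  also have "\<dots> = 6 * m + 1" unfolding card_symmetric_interval I by simp
  finally show ?thesis .
qed

section \<open>Evaluating \<open>mu\<close> in each residue class modulo 4\<close>

lemma mu_circle_eqI:
  assumes "\<And>A. A \<subseteq> {u. norm u = 1} \<Longrightarrow> finite A \<Longrightarrow> card A = n \<Longrightarrow> card (AP3 circle_metric A) \<le> v"
    and "A \<subseteq> {u. norm u = 1}" "finite A" "card A = n" "v \<le> card (AP3 circle_metric A)"
  shows "mu circle_metric n = v"
  unfolding mu_def
proof (rule Max_eqI)
  show "finite {card (AP3 circle_metric A) |A.
      A \<subseteq> mspace circle_metric \<and> finite A \<and> card A = n}"
    by (rule finite_subset[of _ "{..v}"]) (use assms(1) in auto)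
  have "card (AP3 circle_metric A) = v" using assms by (simp add: antisym)
  then show "v \<in> {card (AP3 circle_metric A) |A.
      A \<subseteq> mspace circle_metric \<and> finite A \<and> card A = n}"
    using assms(2-4) by auto
qed (use assms(1) in auto)

lemma mu_circle_0_1:
  assumes "n > 0" "n = 4 * m \<or> n = 4 * m + 1"
  shows "mu circle_metric n = n * (2 * m + 1)"
proof -
  have "4 * m \<le> n" "{} \<subseteq> {0..<int n}" using assms(2) by auto
  from AP3_polygon[OF assms(1) this refl refl] obtain A :: "(real ^ 2) set"
    where A: "A \<subseteq> {u. norm u = 1}" "finite A" "card A = n"
      "card ({0..<int n} \<times> {- int m..int m}) \<le> card (AP3 circle_metric A)"
    by (simp only: UN_empty Diff_empty card.empty diff_zero) metis
  show ?thesis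
  proof (rule mu_circle_eqI[OF _ A(1-3)])
    show "n * (2 * m + 1) \<le> card (AP3 circle_metric A)"
      using A(4) unfolding card_cartesian_product card_symmetric_interval by simp
    fix A' :: "(real ^ 2) set"
    assume "A' \<subseteq> {u. norm u = 1}" "finite A'" "card A' = n"
    from card_AP3_le[OF this assms(1), of "2 * m"] assms(2)
    show "card (AP3 circle_metric A') \<le> n * (2 * m + 1)" by auto
  qed
qed

text \<open>The lower bound removes one vertex from the regular \<open>4 * (m + 1)\<close>-gon. The
  general upper bound is larger by 1, and parity closes the gap.\<close>

lemma mu_circle_3: "mu circle_metric (4 * m + 3) = 8 * m ^ 2 + 14 * m + 5"
proof -
  define N where "N = 4 * (m + 1)"
  define P where "P = {0..<int N} \<times> {- int (m + 1)..int (m + 1)}"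
  define M where "M x = {(b, r) \<in> P. b = x \<or> (b + r) mod int N = x \<or> (b - r) mod int N = x}" for x
  have fin: "finite (M x)" for x
    by (rule finite_subset[of _ P]) (auto simp: M_def P_def)
  have "N > 0" "4 * (m + 1) \<le> N" "{0} \<subseteq> {0..<int N}" by (simp_all add: N_def)
  from AP3_polygon[OF this P_def M_def] obtain A :: "(real ^ 2) set"
    where A: "A \<subseteq> {u. norm u = 1}" "finite A" "card A = N - card {0 :: int}"
      and card_A: "card (P - (\<Union>x\<in>{0}. M x)) \<le> card (AP3 circle_metric A)" by metis
  have A3: "card A = 4 * m + 3" using A(3) by (simp add: N_def)
  show ?thesis
  proof (rule mu_circle_eqI[OF _ A(1,2) A3])
    have "card P - card (M 0) \<le> card (P - M 0)"
      by (rule diff_card_le_card_Diff) (simp add: fin)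
    moreover have "card P = 4 * (m + 1) * (2 * m + 3)"
      unfolding P_def card_cartesian_product card_symmetric_interval card_atLeastLessThan_int
      by (simp, simp add: N_def algebra_simps)
    moreover have "card (M 0) \<le> 6 * (m + 1) + 1"
      unfolding M_def P_def by (rule card_meeting_le) (simp add: N_def)
    ultimately have "4 * (m + 1) * (2 * m + 3) - (6 * (m + 1) + 1) \<le> card (AP3 circle_metric A)"
      using card_A by simp
    then show "8 * m ^ 2 + 14 * m + 5 \<le> card (AP3 circle_metric A)"
      by (simp add: power2_eq_square algebra_simps)
    fix A' :: "(real ^ 2) set"
    assume A': "A' \<subseteq> {u. norm u = 1}" "finite A'" "card A' = 4 * m + 3"
    define z where "z = 4 * m ^ 2 + 7 * m + 3"
    have "card (AP3 circle_metric A') \<le> 4 * m + 3 + (4 * m + 3) * (2 * m + 1)"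
      by (rule card_AP3_le[OF A']) auto
    also have "\<dots> = 2 * z"
      by (simp add: z_def power2_eq_square algebra_simps)
    finally have "card (AP3 circle_metric A') \<le> 2 * z" .
    \<comment> \<open>Nonconstant progressions come in reversed pairs, so the count is odd like
      \<open>card A'\<close>, while the general bound \<open>2 * z\<close> is even.\<close>
    moreover obtain k where k: "card (AP3 circle_metric A') = 2 * k + 1"
      using even_card_AP3[OF A'] by (auto elim: oddE)
    ultimately have "k + 1 \<le> z" by linarith
    then show "card (AP3 circle_metric A') \<le> 8 * m ^ 2 + 14 * m + 5"
      unfolding k z_def by simp
  qed
qed

lemma mu_circle_2:
  assumes "m > 0"
  shows "mu circle_metric (4 * m + 2) = 8 * m ^ 2 + 8 * m + 4"
proof -
  define N where "N = 4 * (m + 1)"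
  define P where "P = {0..<int N} \<times> {- int (m + 1)..int (m + 1)}"
  define M where "M x = {(b, r) \<in> P. b = x \<or> (b + r) mod int N = x \<or> (b - r) mod int N = x}" for x
  have "N > 0" "4 * (m + 1) \<le> N" "{0, 2} \<subseteq> {0..<int N}" by (simp_all add: N_def)
  from AP3_polygon[OF this P_def M_def] obtain A :: "(real ^ 2) set"
    where A: "A \<subseteq> {u. norm u = 1}" "finite A" "card A = N - card {0 :: int, 2}"
      and card_A: "card (P - (\<Union>x\<in>{0, 2}. M x)) \<le> card (AP3 circle_metric A)" by metis
  have A3: "card A = 4 * m + 2" using A(3) by (simp add: N_def)
  show ?thesis
  proof (rule mu_circle_eqI[OF _ A(1,2) A3])
    have fin: "finite (M x)" for x
      by (rule finite_subset[of _ P]) (auto simp: M_def P_def)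
    have cardM: "card (M x) \<le> 6 * (m + 1) + 1" for x
      unfolding M_def P_def by (rule card_meeting_le) (simp add: N_def)
    \<comment> \<open>Removing vertices 0 and 2 destroys these six triples only once: four have one
      removed vertex as middle and the other as an end, two have middle 1 between them. The step 2
      is admissible because \<open>m > 0\<close> gives \<open>2 \<le> m + 1\<close>.\<close>
    have "{(0, 2), (0, - 2), (2, 2), (2, - 2), (1, 1), (1, - 1 :: int)} \<subseteq> M 0 \<inter> M 2"
      using assms by (auto simp: M_def P_def N_def mod_pos_pos_trivial)
    then have "card {(0 :: int, 2), (0, - 2), (2, 2), (2, - 2), (1, 1), (1, - 1 :: int)} \<le> card (M 0 \<inter> M 2)"
      using fin by (intro card_mono) auto
    then have "6 \<le> card (M 0 \<inter> M 2)" by simp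
    moreover have "card (M 0) + card (M 2) = card (M 0 \<union> M 2) + card (M 0 \<inter> M 2)"
      using fin by (intro card_Un_Int)
    moreover have "card P - card (M 0 \<union> M 2) \<le> card (P - (M 0 \<union> M 2))"
      by (rule diff_card_le_card_Diff) (simp add: fin)
    moreover have "card P = 4 * (m + 1) * (2 * m + 3)"
      unfolding P_def card_cartesian_product card_symmetric_interval card_atLeastLessThan_int
      by (simp, simp add: N_def algebra_simps)
    ultimately have "4 * (m + 1) * (2 * m + 3) - (12 * (m + 1) - 4) \<le> card (AP3 circle_metric A)"
      using card_A cardM[of 0] cardM[of 2] by simp
    then show "8 * m ^ 2 + 8 * m + 4 \<le> card (AP3 circle_metric A)"
      by (simp add: power2_eq_square algebra_simps)
    fix A' :: "(real ^ 2) set"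
    assume A': "A' \<subseteq> {u. norm u = 1}" "finite A'" "card A' = 4 * m + 2"
    have "card (AP3 circle_metric A') \<le> 4 * m + 2 + 2 * ((2 * m + 1) * (2 * m + 1 - 1) + 1)"
      by (rule card_AP3_le_odd[OF A']) auto
    then show "card (AP3 circle_metric A') \<le> 8 * m ^ 2 + 8 * m + 4"
      by (simp add: power2_eq_square algebra_simps)
  qed
qed

theorem theorem1p4:
  fixes n :: nat
  assumes "n > 0" and "n \<noteq> 2"
  shows "real (mu circle_metric n) = 1 / 2 * real n ^ 2 +
    (if n mod 4 = 0 then real n
     else if n mod 4 = 1 then 1 / 2 * real n
     else if n mod 4 = 2 then 2
     else 1 / 2 * real n - 1)"
proof -
  define m where "m = n div 4"
  have n: "n = 4 * m + n mod 4" by (simp add: m_def)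
  consider "n mod 4 = 0" | "n mod 4 = 1" | "n mod 4 = 2" | "n mod 4 = 3" by linarith
  then show ?thesis
  proof cases
    case 1
    then have "n = 4 * m" using n by simp
    then show ?thesis
      using mu_circle_0_1[of n m] assms by (simp add: power2_eq_square algebra_simps)
  next
    case 2
    then have "n = 4 * m + 1" using n by simp
    then show ?thesis
      using mu_circle_0_1[of n m] assms 2 by (simp add: power2_eq_square algebra_simps)
  next
    case 3
    then have "n = 4 * m + 2" using n by simp
    then show ?thesis
      using mu_circle_2[of m] assms 3 by (simp add: power2_eq_square algebra_simps)
  next
    case 4
    then have "n = 4 * m + 3" using n by simp
    then show ?thesis
      using mu_circle_3[of m] assms 4 by (simp add: power2_eq_square algebra_simps)
  qed
qed

end
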